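(* Let $(\mathbb{R},\mathcal{A},\ell)$ be the Lebesgue measure space on $\mathbb{R}$, where $\mathcal{A}$ is the $\sigma$-algebra of all Lebesgue measurable subsets of $\mathbb{R}$ and $\ell$ is Lebesgue measure. Then the zero-divisor graph $\Gamma(\mathcal{M}(\mathbb{R},\mathcal{A}))$ and the comaximal graph $\Gamma'_2(\mathcal{M}(\mathbb{R},\mathcal{A}))$ are isomorphic as graphs.
   Context: $\mathcal{M}(\mathbb{R},\mathcal{A})$ is the commutative ring (pointwise operations) of all Lebesgue measurable functions $f:\mathbb{R}\to\mathbb{R}$ (genuine functions, not classes modulo a.e. equality); $Z(f)=\{x\in\mathbb{R}:f(x)=0\}$. Both graphs are simple graphs with vertex set $\mathscr{D}=\{f\in\mathcal{M}(\mathbb{R},\mathcal{A}):\ell(Z(f))>0\text{ and }\ell(\mathbb{R}\setminus Z(f))>0\}$. Distinct $f,g\in\mathscr{D}$ are adjacent in the zero-divisor graph $\Gamma$ iff $\ell((\mathbb{R}\setminus Z(f))\cap(\mathbb{R}\setminus Z(g)))=0$, and adjacent in the comaximal graph $\Gamma'_2$ iff $\langle f\rangle+\langle g\rangle=\langle u\rangle$ (sum of principal ideals) for some $u\in\mathcal{M}(\mathbb{R},\mathcal{A})$ with $\ell(Z(u))=0$. A graph isomorphism is a bijection of vertex sets preserving adjacency in both directions. *)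

theory Defs
  imports "HOL-Analysis.Analysis" "HOL-Algebra.Ideal"
begin

(* "lebesgue" is the completion of the Borel-Lebesgue measure "lborel", so its sets are all the
   Lebesgue measurable sets. Functions equal almost everywhere are not identified. *)
definition leb_ring :: "(real \<Rightarrow> real) ring" where
  "leb_ring =
    \<lparr>carrier = borel_measurable lebesgue,
     monoid.mult = (\<lambda>f g x. f x * g x),
     one = (\<lambda>x. 1),
     zero = (\<lambda>x. 0),
     add = (\<lambda>f g x. f x + g x)\<rparr>"

definition zero_set :: "(real \<Rightarrow> real) \<Rightarrow> real set" where
  "zero_set f = {x. f x = 0}"

record 'v ugraph =
  verts :: "'v set"
  edges :: "'v set set"

definition simple_ugraph :: "'v ugraph \<Rightarrow> bool" where
  "simple_ugraph G \<longleftrightarrow> (\<forall>e\<in>edges G. e \<subseteq> verts G \<and> card e = 2)"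

definition ugraph_isomorphism :: "('v \<Rightarrow> 'w) \<Rightarrow> 'v ugraph \<Rightarrow> 'w ugraph \<Rightarrow> bool" where
  "ugraph_isomorphism \<phi> G H \<longleftrightarrow>
     bij_betw \<phi> (verts G) (verts H) \<and>
     (\<forall>x\<in>verts G. \<forall>y\<in>verts G. {x, y} \<in> edges G \<longleftrightarrow> {\<phi> x, \<phi> y} \<in> edges H)"

definition ugraph_isomorphic :: "'v ugraph \<Rightarrow> 'w ugraph \<Rightarrow> bool" where
  "ugraph_isomorphic G H \<longleftrightarrow> (\<exists>\<phi>. ugraph_isomorphism \<phi> G H)"

definition leb_vertices :: "(real \<Rightarrow> real) set" where
  "leb_vertices = {f \<in> carrier leb_ring.
     emeasure lebesgue (zero_set f) > 0 \<and> emeasure lebesgue (UNIV - zero_set f) > 0}"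

definition zero_divisor_graph :: "(real \<Rightarrow> real) ugraph" where
  "zero_divisor_graph =
    \<lparr>verts = leb_vertices,
     edges = {{f, g} | f g. f \<in> leb_vertices \<and> g \<in> leb_vertices \<and> f \<noteq> g \<and>
       emeasure lebesgue ((UNIV - zero_set f) \<inter> (UNIV - zero_set g)) = 0}\<rparr>"

definition comaximal_graph :: "(real \<Rightarrow> real) ugraph" where
  "comaximal_graph =
    \<lparr>verts = leb_vertices,
     edges = {{f, g} | f g. f \<in> leb_vertices \<and> g \<in> leb_vertices \<and> f \<noteq> g \<and>
       (\<exists>u\<in>carrier leb_ring. emeasure lebesgue (zero_set u) = 0 \<and>
          PIdl\<^bsub>leb_ring\<^esub> f <+>\<^bsub>leb_ring\<^esub> PIdl\<^bsub>leb_ring\<^esub> g = PIdl\<^bsub>leb_ring\<^esub> u)}\<rparr>"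

lemma cring_leb_ring: "cring leb_ring"
proof (rule cringI)
  show "abelian_group leb_ring"
  proof (rule abelian_groupI)
    fix f assume f: "f \<in> carrier leb_ring"
    then have "(\<lambda>x. - f x) \<in> carrier leb_ring"
      by (simp add: leb_ring_def)
    then show "\<exists>g\<in>carrier leb_ring. g \<oplus>\<^bsub>leb_ring\<^esub> f = \<zero>\<^bsub>leb_ring\<^esub>"
      by (rule rev_bexI) (simp add: leb_ring_def)
  qed (auto simp: leb_ring_def add_ac intro!: borel_measurable_add)
  show "Group.comm_monoid leb_ring"
    by (rule comm_monoidI) (auto simp: leb_ring_def mult_ac intro!: borel_measurable_times)
qed (auto simp: leb_ring_def algebra_simps)

lemma simple_zero_divisor_graph: "simple_ugraph zero_divisor_graph"
  unfolding simple_ugraph_def zero_divisor_graph_def by auto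

lemma simple_comaximal_graph: "simple_ugraph comaximal_graph"
  unfolding simple_ugraph_def comaximal_graph_def by auto

end

theory Submission
  imports Defs
begin

text \<open>
  Adjacency in either graph depends only on zero sets up to null sets: \<open>f\<close>, \<open>g\<close> are adjacent in the
  zero-divisor graph iff almost everywhere \<open>f = 0\<close> or \<open>g = 0\<close>, and in the comaximal graph iff almost
  everywhere \<open>f \<noteq> 0\<close> or \<open>g \<noteq> 0\<close> (the principal ideal of \<open>f\<close> consists of all measurable functions
  vanishing on \<open>Z(f)\<close>, so a sum of two such ideals belongs to the intersection of the zero sets).
  Hence any bijection of the vertices that complements zero sets up to null sets is an isomorphism.
  An injection with this property sends \<open>f\<close> to the indicator of \<open>Z(f)\<close>, altered on a null set of
  cardinality continuum so as to encode all values of \<open>f\<close>; the Schroeder--Bernstein construction,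
  applied to this injection in both directions, turns it into a bijection.
\<close>

section \<open>A null set of cardinality continuum\<close>

text \<open>The point of the Cantor set whose ternary digits after the point are 2 at the positions
  in \<open>S\<close> and 0 elsewhere; positions count from 0, hence the factor
  \<open>2/3\<close>.\<close>

definition ternary :: "nat set \<Rightarrow> real" where
  "ternary S = (\<Sum>n. (if n \<in> S then 2/3 else 0) * (1/3) ^ n)"

lemma summable_ternary: "summable (\<lambda>n. (if n \<in> S then 2/3 else 0) * (1/3::real) ^ n)"
proof (rule summable_comparison_test')
  show "summable (\<lambda>n. (1/3::real) ^ n)"
    by (rule summable_geometric) simp
  show "norm ((if n \<in> S then 2/3 else 0) * (1/3::real) ^ n) \<le> (1/3) ^ n" for n
    by (simp add: norm_mult norm_power)
qed

text \<open>Self-similarity of the Cantor set: splitting off the first digit leaves a copy scaled by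
  \<open>1/3\<close>. Both injectivity and the measure bound rest on this.\<close>

lemma ternary_shift:
  "ternary S = (if 0 \<in> S then 2/3 else 0) + ternary {n. Suc n \<in> S} / 3"
  using suminf_split_head[OF summable_ternary[of S]]
    suminf_mult[OF summable_ternary[of "{n. Suc n \<in> S}"], of "1/3"]
  by (simp add: ternary_def algebra_simps)

lemma ternary_nonneg: "0 \<le> ternary S"
  unfolding ternary_def by (intro suminf_nonneg summable_ternary) auto

lemma ternary_le_1: "ternary S \<le> 1"
proof -
  have "ternary S \<le> (\<Sum>n. 2/3 * (1/3) ^ n)"
    unfolding ternary_def
    by (intro suminf_le summable_ternary summable_mult) (auto simp: summable_geometric)
  also have "\<dots> = 1"
    by (subst suminf_mult) (auto simp: suminf_geometric summable_geometric)
  finally show ?thesis .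
qed

text \<open>The first digit can be read off, since values with digit 0 are at most
  \<open>1/3\<close> and those with digit 2 at least \<open>2/3\<close>. Cancelling it leaves equal
  tails, so induction on the position works with \<open>S\<close> and \<open>T\<close>
  arbitrary.\<close>

lemma inj_ternary: "inj ternary"
proof (rule injI)
  have "n \<in> S \<longleftrightarrow> n \<in> T" if "ternary S = ternary T" for n S T
    using that
  proof (induction n arbitrary: S T)
    case (0 S T)
    then show ?case
      using ternary_shift[of S] ternary_shift[of T]
        ternary_nonneg[of "{n. Suc n \<in> S}"] ternary_nonneg[of "{n. Suc n \<in> T}"]
        ternary_le_1[of "{n. Suc n \<in> S}"] ternary_le_1[of "{n. Suc n \<in> T}"]
      by (auto split: if_splits)
  next
    case (Suc n S T)
    have "ternary {n. Suc n \<in> S} = ternary {n. Suc n \<in> T}"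
      using Suc.prems ternary_shift[of S] ternary_shift[of T]
        ternary_nonneg[of "{n. Suc n \<in> S}"] ternary_nonneg[of "{n. Suc n \<in> T}"]
        ternary_le_1[of "{n. Suc n \<in> S}"] ternary_le_1[of "{n. Suc n \<in> T}"]
      by (auto split: if_splits)
    from Suc.IH[OF this] show ?case by simp
  qed
  then show "S = T" if "ternary S = ternary T" for S T
    using that by blast
qed

text \<open>The usual stages of the Cantor construction: two copies of a cover, each scaled by
  \<open>1/3\<close>, cover again, so each stage multiplies the bound by \<open>2/3\<close>.\<close>

lemma range_ternary_cover:
  "\<exists>T. compact T \<and> range ternary \<subseteq> T \<and> measure lebesgue T \<le> (2/3) ^ n"
proof (induction n)
  case 0
  show ?case
    using ternary_nonneg ternary_le_1 by (intro exI[of _ "{0..1}"]) auto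
next
  case (Suc n)
  then obtain T where T: "compact T" "range ternary \<subseteq> T" "measure lebesgue T \<le> (2/3) ^ n"
    by blast
  define U where "U a = (\<lambda>x. (1/3) *\<^sub>R x + a) ` T" for a
  have U: "compact (U a)" "measure lebesgue (U a) = measure lebesgue T / 3" for a
    unfolding U_def using T(1) measure_lebesgue_affine[of "1/3" a T]
    by (auto intro!: compact_continuous_image continuous_intros)
  have "range ternary \<subseteq> U 0 \<union> U (2/3)"
  proof clarify
    fix S assume "ternary S \<notin> U (2/3)"
    moreover have "ternary {n. Suc n \<in> S} \<in> T"
      using T(2) by blast
    ultimately show "ternary S \<in> U 0"
      using ternary_shift[of S] by (auto simp: U_def split: if_splits)
  qed
  moreover have "measure lebesgue (U 0 \<union> U (2/3)) \<le> (2/3) ^ Suc n"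
    using measure_Un_le[of "U 0" lebesgue "U (2/3)"] U T(3)
    by (auto simp: fmeasurableD lmeasurable_compact)
  ultimately show ?case
    using U by (intro exI[of _ "U 0 \<union> U (2/3)"]) (auto intro: compact_Un)
qed

text \<open>\<open>C\<close> is the range of \<open>ternary\<close>, and \<open>e\<close> decodes a
  point of it to a set of naturals and then to a real.\<close>

lemma null_set_onto_reals:
  obtains C :: "real set" and e :: "real \<Rightarrow> real"
  where "negligible C" "e ` C = UNIV"
proof -
  have "negligible (range ternary)"
  proof (rule negligible_outer_le[THEN iffD2], intro allI impI)
    fix r :: real assume "r > 0"
    then obtain n where "(2/3) ^ n < r"
      using real_arch_pow_inv[of r "2/3"] by auto
    with range_ternary_cover[of n]
    show "\<exists>T. range ternary \<subseteq> T \<and> T \<in> lmeasurable \<and> measure lebesgue T \<le> r"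
      by (meson less_imp_le lmeasurable_compact order_trans)
  qed
  moreover obtain b :: "nat set \<Rightarrow> real" where "bij b"
    using nat_sets_eqpoll_reals by (auto simp: eqpoll_def)
  then have "(b \<circ> inv_into UNIV ternary) ` range ternary = UNIV"
    by (simp add: image_comp comp_def inj_ternary bij_is_surj)
  ultimately show thesis by (rule that)
qed

section \<open>Reduction to zero sets\<close>

lemma emeasure_lebesgue_eq_0_iff:
  "A \<in> sets lebesgue \<Longrightarrow> emeasure lebesgue A = 0 \<longleftrightarrow> (AE x in lebesgue. x \<notin> A)"
  by (subst AE_iff_measurable[where N = A]) auto

lemma zero_set_measurable: "f \<in> borel_measurable lebesgue \<Longrightarrow> zero_set f \<in> sets lebesgue"
  using measurable_sets[of f lebesgue borel "{0}"] by (simp add: zero_set_def vimage_def)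

lemma leb_vertices_iff:
  "f \<in> leb_vertices \<longleftrightarrow> f \<in> borel_measurable lebesgue \<and>
     \<not> (AE x in lebesgue. f x \<noteq> 0) \<and> \<not> (AE x in lebesgue. f x = 0)"
proof (cases "f \<in> borel_measurable lebesgue")
  case True
  then have m: "zero_set f \<in> sets lebesgue" "UNIV - zero_set f \<in> sets lebesgue"
    using zero_set_measurable[OF True] sets.compl_sets[of "zero_set f" lebesgue] by auto
  with True show ?thesis
    by (simp add: leb_vertices_def leb_ring_def zero_less_iff_neq_zero emeasure_lebesgue_eq_0_iff
        del: emeasure_completion)
      (simp add: zero_set_def)
qed (simp add: leb_vertices_def leb_ring_def)

lemma edge_zero_divisor_graph_iff:
  assumes "f \<in> leb_vertices" "g \<in> leb_vertices"
  shows "{f, g} \<in> edges zero_divisor_graph \<longleftrightarrow> f \<noteq> g \<and> (AE x in lebesgue. f x = 0 \<or> g x = 0)"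
proof -
  have "(UNIV - zero_set f) \<inter> (UNIV - zero_set g) \<in> sets lebesgue"
    using assms zero_set_measurable sets.compl_sets[of _ lebesgue]
    by (intro sets.Int) (auto simp: leb_vertices_iff)
  then have "emeasure lebesgue ((UNIV - zero_set f) \<inter> (UNIV - zero_set g)) = 0 \<longleftrightarrow>
      (AE x in lebesgue. f x = 0 \<or> g x = 0)"
    by (simp add: emeasure_lebesgue_eq_0_iff del: emeasure_completion) (simp add: zero_set_def disj_commute imp_conv_disj)
  with assms show ?thesis
    by (auto simp: zero_divisor_graph_def doubleton_eq_iff Int_commute)
qed

lemma PIdl_leb_ring:
  assumes "f \<in> borel_measurable lebesgue"
  shows "PIdl\<^bsub>leb_ring\<^esub> f = {h \<in> borel_measurable lebesgue. zero_set f \<subseteq> zero_set h}"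
proof (intro equalityI subsetI)
  fix h assume h: "h \<in> {h \<in> borel_measurable lebesgue. zero_set f \<subseteq> zero_set h}"
  \<comment> \<open>As division by zero yields 0, the quotient is total and measurable; on the zeros
    of \<open>f\<close> both \<open>h\<close> and \<open>k * f\<close> vanish.\<close>
  define k where "k x = h x / f x" for x
  have "(\<lambda>x. h x / f x) \<in> borel_measurable lebesgue"
    using assms h by (intro borel_measurable_divide) auto
  then have "k \<in> carrier leb_ring"
    by (simp add: k_def[abs_def] leb_ring_def)
  moreover have "h = k \<otimes>\<^bsub>leb_ring\<^esub> f"
    using h by (auto simp: k_def leb_ring_def zero_set_def fun_eq_iff)
  ultimately show "h \<in> PIdl\<^bsub>leb_ring\<^esub> f"
    unfolding cgenideal_def by blast
qed (use assms in \<open>auto simp: cgenideal_def leb_ring_def zero_set_def\<close>)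

lemma PIdl_leb_ring_add:
  assumes f: "f \<in> borel_measurable lebesgue" and g: "g \<in> borel_measurable lebesgue"
  shows "PIdl\<^bsub>leb_ring\<^esub> f <+>\<^bsub>leb_ring\<^esub> PIdl\<^bsub>leb_ring\<^esub> g =
    {h \<in> borel_measurable lebesgue. zero_set f \<inter> zero_set g \<subseteq> zero_set h}"
    (is "?S = ?T")
proof (intro equalityI subsetI)
  fix h assume "h \<in> ?S"
  then obtain p q where "p \<in> PIdl\<^bsub>leb_ring\<^esub> f" "q \<in> PIdl\<^bsub>leb_ring\<^esub> g" "h = (\<lambda>x. p x + q x)"
    unfolding set_add_def' by (auto simp: leb_ring_def[THEN arg_cong[where f = add]])
  then show "h \<in> ?T"
    using f g by (auto simp: PIdl_leb_ring zero_set_def subset_iff)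
next
  fix h assume h: "h \<in> ?T"
  \<comment> \<open>Cut \<open>h\<close> along the zero set of \<open>f\<close>. The part
    \<open>q\<close> vanishes on the zeros of \<open>g\<close>, because \<open>h\<close> vanishes on
    the common zeros.\<close>
  define p q where "p x = (if f x = 0 then 0 else h x)" and "q x = (if f x = 0 then h x else 0)" for x
  have [measurable]: "f \<in> borel_measurable lebesgue" "h \<in> borel_measurable lebesgue"
    using f h by auto
  have "p \<in> borel_measurable lebesgue" "q \<in> borel_measurable lebesgue"
    unfolding p_def[abs_def] q_def[abs_def] by measurable
  then have "p \<in> PIdl\<^bsub>leb_ring\<^esub> f" "q \<in> PIdl\<^bsub>leb_ring\<^esub> g"
    using f g h by (auto simp: PIdl_leb_ring zero_set_def p_def q_def)
  moreover have "h = p \<oplus>\<^bsub>leb_ring\<^esub> q"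
    by (auto simp: leb_ring_def p_def q_def)
  ultimately show "h \<in> ?S"
    unfolding set_add_def' by blast
qed

lemma PIdl_leb_ring_add_principal_iff:
  assumes f: "f \<in> borel_measurable lebesgue" and g: "g \<in> borel_measurable lebesgue"
    and u: "u \<in> borel_measurable lebesgue"
  shows "PIdl\<^bsub>leb_ring\<^esub> f <+>\<^bsub>leb_ring\<^esub> PIdl\<^bsub>leb_ring\<^esub> g = PIdl\<^bsub>leb_ring\<^esub> u \<longleftrightarrow>
    zero_set u = zero_set f \<inter> zero_set g"
  unfolding PIdl_leb_ring_add[OF f g] PIdl_leb_ring[OF u]
proof
  assume eq: "{h \<in> borel_measurable lebesgue. zero_set f \<inter> zero_set g \<subseteq> zero_set h} =
    {h \<in> borel_measurable lebesgue. zero_set u \<subseteq> zero_set h}"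
  have "zero_set f \<inter> zero_set g \<subseteq> zero_set h \<longleftrightarrow> zero_set u \<subseteq> zero_set h"
    if "h \<in> borel_measurable lebesgue" for h
    using eq that by blast
  \<comment> \<open>Testing with \<open>f\<close> and \<open>g\<close> puts
    \<open>zero_set u\<close> inside both zero sets; testing with \<open>u\<close> gives the reverse
    inclusion.\<close>
  from this[OF f] this[OF g] this[OF u] show "zero_set u = zero_set f \<inter> zero_set g"
    by blast
qed simp

lemma edge_comaximal_graph_iff:
  assumes "f \<in> leb_vertices" "g \<in> leb_vertices"
  shows "{f, g} \<in> edges comaximal_graph \<longleftrightarrow> f \<noteq> g \<and> (AE x in lebesgue. f x \<noteq> 0 \<or> g x \<noteq> 0)"
proof -
  define E where "E f g \<longleftrightarrow> (\<exists>u\<in>carrier leb_ring. emeasure lebesgue (zero_set u) = 0 \<and>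
    PIdl\<^bsub>leb_ring\<^esub> f <+>\<^bsub>leb_ring\<^esub> PIdl\<^bsub>leb_ring\<^esub> g = PIdl\<^bsub>leb_ring\<^esub> u)" for f g
  have *: "E f g \<longleftrightarrow> (AE x in lebesgue. f x \<noteq> 0 \<or> g x \<noteq> 0)"
    if "f \<in> borel_measurable lebesgue" "g \<in> borel_measurable lebesgue" for f g
  proof -
    have "zero_set f \<inter> zero_set g \<in> sets lebesgue"
      using that by (auto intro: zero_set_measurable)
    \<comment> \<open>Absolute values prevent cancellation, so this sum serves as the generator
      \<open>u\<close>.\<close>
    moreover have "zero_set (\<lambda>x. \<bar>f x\<bar> + \<bar>g x\<bar>) = zero_set f \<inter> zero_set g"
      by (auto simp: zero_set_def)
    moreover have "(\<lambda>x. \<bar>f x\<bar> + \<bar>g x\<bar>) \<in> borel_measurable lebesgue"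
      using that by simp
    moreover have "E f g \<longleftrightarrow> (\<exists>u\<in>borel_measurable lebesgue. emeasure lebesgue (zero_set u) = 0 \<and>
        zero_set u = zero_set f \<inter> zero_set g)"
      unfolding E_def using PIdl_leb_ring_add_principal_iff[OF that]
      by (simp add: leb_ring_def cong: bex_cong del: emeasure_completion)
    ultimately have "E f g \<longleftrightarrow> emeasure lebesgue (zero_set f \<inter> zero_set g) = 0"
      by metis
    with \<open>zero_set f \<inter> zero_set g \<in> sets lebesgue\<close> show ?thesis
      by (simp add: emeasure_lebesgue_eq_0_iff del: emeasure_completion) (simp add: zero_set_def)
  qed
  \<comment> \<open>An unordered edge may arise from either ordering of its ends; by
    \<open>*\<close> the two conditions agree.\<close>
  have "{f, g} \<in> edges comaximal_graph \<longleftrightarrow> f \<noteq> g \<and> (E f g \<or> E g f)"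
    using assms by (auto simp: comaximal_graph_def doubleton_eq_iff E_def)
  with assms * show ?thesis
    by (auto simp: leb_vertices_iff disj_commute)
qed

section \<open>A bijection complementing zero sets\<close>

text \<open>Besides the bijection, this records that every value comes from \<open>f\<close> or from
  inverting \<open>g\<close>, so that a relation respected by both injections passes to
  \<open>h\<close>.\<close>

lemma Schroeder_Bernstein_selection:
  assumes f: "inj_on f A" "f ` A \<subseteq> B" and g: "inj_on g B" "g ` B \<subseteq> A"
  shows "\<exists>h. bij_betw h A B \<and> (\<forall>x\<in>A. h x = f x \<or> g (h x) = x)"
proof -
  define X where "X = lfp (\<lambda>X. A - g ` (B - f ` X))"
  have X: "X = A - g ` (B - f ` X)"
    unfolding X_def by (rule lfp_unfold) (blast intro: monoI)
  define h where "h x = (if x \<in> X then f x else inv_into B g x)" for x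
  have "bij_betw h X (f ` X)"
    using X inj_on_subset[OF f(1), of X] by (auto simp: h_def bij_betw_def inj_on_def)
  moreover have "bij_betw h (A - X) (B - f ` X)"
  proof -
    have "A - X = g ` (B - f ` X)"
      using X g(2) by blast
    moreover have "bij_betw (inv_into B g) (g ` (B - f ` X)) (B - f ` X)"
      using bij_betw_inv_into_subset[OF inj_on_imp_bij_betw[OF g(1)]] by auto
    ultimately show ?thesis
      by (subst bij_betw_cong[where g = "inv_into B g"]) (auto simp: h_def)
  qed
  ultimately have "bij_betw h (X \<union> (A - X)) (f ` X \<union> (B - f ` X))"
    by (rule bij_betw_combine) auto
  moreover have "X \<union> (A - X) = A" "f ` X \<union> (B - f ` X) = B"
    using X f(2) by blast+
  ultimately have "bij_betw h A B"
    by simp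
  moreover have "h x = f x \<or> g (h x) = x" if "x \<in> A" for x
    using X that by (auto simp: h_def intro!: f_inv_into_f)
  ultimately show ?thesis by blast
qed

definition ae_complement :: "(real \<Rightarrow> real) \<Rightarrow> (real \<Rightarrow> real) \<Rightarrow> bool" where
  "ae_complement f g \<longleftrightarrow> (AE x in lebesgue. f x = 0 \<longleftrightarrow> g x \<noteq> 0)"

lemma ae_complement_sym: "ae_complement f g \<Longrightarrow> ae_complement g f"
  unfolding ae_complement_def by (rule AE_mp, assumption) auto

text \<open>Complementing zero sets swaps the two positivity conditions that define a
  vertex.\<close>

lemma ae_complement_leb_vertices:
  assumes "f \<in> leb_vertices" "g \<in> borel_measurable lebesgue" "ae_complement f g"
  shows "g \<in> leb_vertices"
proof -
  have "(AE x in lebesgue. f x = 0) \<longleftrightarrow> (AE x in lebesgue. g x \<noteq> 0)"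
    "(AE x in lebesgue. f x \<noteq> 0) \<longleftrightarrow> (AE x in lebesgue. g x = 0)"
    using assms(3) unfolding ae_complement_def by (auto elim: AE_mp)
  with assms show ?thesis by (simp add: leb_vertices_iff)
qed

lemma inj_ae_complement:
  obtains \<psi> :: "(real \<Rightarrow> real) \<Rightarrow> real \<Rightarrow> real"
  where "inj \<psi>" "\<And>f. ae_complement f (\<psi> f)"
    "\<And>f. f \<in> borel_measurable lebesgue \<Longrightarrow> \<psi> f \<in> borel_measurable lebesgue"
proof -
  obtain C :: "real set" and e :: "real \<Rightarrow> real" where C: "negligible C" and e: "e ` C = UNIV"
    by (rule null_set_onto_reals)
  define \<psi> :: "(real \<Rightarrow> real) \<Rightarrow> real \<Rightarrow> real"
    where "\<psi> f x = (if x \<in> C then f (e x) else of_bool (f x = 0))" for f x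
  have ae: "AE x in lebesgue. x \<notin> C"
    using C by (simp add: negligible_iff_null_sets AE_not_in)
  show thesis
  proof
    show "inj \<psi>"
    proof (rule injI, rule ext)
      fix f g y assume "\<psi> f = \<psi> g"
      \<comment> \<open>Decoding: the value of \<open>f\<close> at \<open>y\<close> is stored at a
        point of \<open>C\<close> that \<open>e\<close> maps to \<open>y\<close>.\<close>
      obtain x where "x \<in> C" "y = e x"
        using e by blast
      with fun_cong[OF \<open>\<psi> f = \<psi> g\<close>, of x] show "f y = g y"
        by (simp add: \<psi>_def)
    qed
    show "ae_complement f (\<psi> f)" for f
      using ae unfolding ae_complement_def by (rule AE_mp) (auto simp: \<psi>_def)
    show "\<psi> f \<in> borel_measurable lebesgue" if "f \<in> borel_measurable lebesgue" for f
    \<comment> \<open>The values stored on \<open>C\<close> can be arbitrarily irregular, but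
      Lebesgue measure is complete, so changing the indicator on a null set keeps it
      measurable.\<close>
    proof (rule borel_measurable_AE)
      have "{x. f x = 0} \<in> sets lebesgue"
        using zero_set_measurable[OF that] by (simp add: zero_set_def)
      then show "(indicator {x. f x = 0} :: real \<Rightarrow> real) \<in> borel_measurable lebesgue"
        by simp
      show "AE x in lebesgue. indicator {x. f x = 0} x = \<psi> f x"
        using ae by (rule AE_mp) (auto simp: \<psi>_def)
    qed
  qed
qed

lemma bij_ae_complement:
  obtains \<phi> where "bij_betw \<phi> leb_vertices leb_vertices" "\<And>f. f \<in> leb_vertices \<Longrightarrow> ae_complement f (\<phi> f)"
proof -
  obtain \<psi> :: "(real \<Rightarrow> real) \<Rightarrow> real \<Rightarrow> real"
    where \<psi>: "inj \<psi>" "\<And>f. ae_complement f (\<psi> f)"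
      "\<And>f. f \<in> borel_measurable lebesgue \<Longrightarrow> \<psi> f \<in> borel_measurable lebesgue"
    by (rule inj_ae_complement) (rule that)
  have inj: "inj_on \<psi> leb_vertices"
    using \<psi>(1) by (rule inj_on_subset) simp
  have sub: "\<psi> ` leb_vertices \<subseteq> leb_vertices"
  proof (rule image_subsetI)
    fix f assume f: "f \<in> leb_vertices"
    then have "f \<in> borel_measurable lebesgue"
      by (simp add: leb_vertices_iff)
    from f \<psi>(3)[OF this] \<psi>(2) show "\<psi> f \<in> leb_vertices"
      by (rule ae_complement_leb_vertices)
  qed
  obtain \<phi> where "bij_betw \<phi> leb_vertices leb_vertices"
    and \<phi>: "\<And>f. f \<in> leb_vertices \<Longrightarrow> \<phi> f = \<psi> f \<or> \<psi> (\<phi> f) = f"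
    using Schroeder_Bernstein_selection[OF inj sub inj sub] by blast
  moreover have "ae_complement f (\<phi> f)" if "f \<in> leb_vertices" for f
    \<comment> \<open>If \<open>\<phi> f\<close> was obtained by inverting \<open>\<psi>\<close>,
      then \<open>f\<close> complements \<open>\<phi> f\<close>, and symmetry reverses this.\<close>
    using \<phi>[OF that] \<psi>(2)[of f] ae_complement_sym[OF \<psi>(2)[of "\<phi> f"]] by auto
  ultimately show thesis using that by blast
qed

theorem theorem6p2p7: "ugraph_isomorphic zero_divisor_graph comaximal_graph"
proof -
  obtain \<phi> where bij: "bij_betw \<phi> leb_vertices leb_vertices"
    and \<phi>: "\<And>f. f \<in> leb_vertices \<Longrightarrow> ae_complement f (\<phi> f)"
    by (rule bij_ae_complement) blast
  have "{f, g} \<in> edges zero_divisor_graph \<longleftrightarrow> {\<phi> f, \<phi> g} \<in> edges comaximal_graph"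
    if f: "f \<in> leb_vertices" and g: "g \<in> leb_vertices" for f g
  proof -
    have "AE x in lebesgue. (f x = 0 \<or> g x = 0) \<longleftrightarrow> (\<phi> f x \<noteq> 0 \<or> \<phi> g x \<noteq> 0)"
      using \<phi>[OF f] \<phi>[OF g] unfolding ae_complement_def by eventually_elim auto
    then have "(AE x in lebesgue. f x = 0 \<or> g x = 0) \<longleftrightarrow>
        (AE x in lebesgue. \<phi> f x \<noteq> 0 \<or> \<phi> g x \<noteq> 0)"
      by (rule eventually_subst)
    moreover have "\<phi> f \<in> leb_vertices" "\<phi> g \<in> leb_vertices"
      using bij f g by (auto dest: bij_betwE)
    moreover have "f = g \<longleftrightarrow> \<phi> f = \<phi> g"
      using bij f g by (auto dest: bij_betw_imp_inj_on inj_onD)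
    ultimately show ?thesis
      using f g by (simp add: edge_zero_divisor_graph_iff edge_comaximal_graph_iff)
  qed
  moreover have "verts zero_divisor_graph = leb_vertices" "verts comaximal_graph = leb_vertices"
    by (simp_all add: zero_divisor_graph_def comaximal_graph_def)
  ultimately show ?thesis
    using bij unfolding ugraph_isomorphic_def ugraph_isomorphism_def by auto
qed

end
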